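(* Let $\mathcal F=(V,E,\phi)$ be a framework. If $\mathcal F$ is edge decomposable then it is uniquely decomposable. More precisely, if $E_{nd}=C_1\sqcup\dots\sqcup C_r$ is a partition of the set of non-degenerate edges into non-empty contractible dependent sets of edges, then $\mathbb{DC}(\mathcal F)$ is a simplicial cone of dimension $r$ whose rays are spanned by $\mathbb 1_{C_1},\dots,\mathbb 1_{C_r}$, and $\mathcal F=\mathcal F_{C_1}+\dots+\mathcal F_{C_r}$ is the unique decomposition of $\mathcal F$ into indecomposable frameworks with distinct support.
   Context: A framework in $\mathbb R^d$ is a triple $\mathcal F=(V,E,\phi)$ with $V$ a finite set (vertices), $E\subseteq\binom{V}{2}$ (edges), and $\phi:V\to\mathbb R^d$; it is connected if the graph $(V,E)$ is. An edge $uv$ is degenerate if $\phi_u=\phi_v$; the set $E_{nd}$ of non-degenerate edges is called the support of $\mathcal F$. A framework $(V,E,\psi)$ in $\mathbb R^d$ on the same graph is a deformation of $\mathcal F$ if for every $uv\in E$ there is $\lambda_{uv}\ge 0$ with $\psi_v-\psi_u=\lambda_{uv}(\phi_v-\phi_u)$. Its edge-deformation vector in $\mathbb R_{\ge 0}^E$ has coordinate $\lambda_{uv}$ for non-degenerate $uv$ and $0$ for degenerate $uv$; it determines the deformation up to translation of the connected components. The deformation cone $\mathbb{DC}(\mathcal F)\subset\mathbb R^E$ is the set of edge-deformation vectors of all deformations of $\mathcal F$. Frameworks on the same graph are added pointwise: $(V,E,\phi)+(V,E,\psi)=(V,E,\phi+\psi)$. Decompositions of frameworks as sums are considered up to translation.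 A connected framework is indecomposable if for each of its deformations $(V,E,\psi)$ there are $\alpha\ge0$ and $t\in\mathbb R^d$ with $\psi_v=\alpha\phi_v+t$ for all $v\in V$; by convention, a disconnected framework is decomposable. A framework $\mathcal F$ is uniquely decomposable if $\mathbb{DC}(\mathcal F)$ is simplicial (its rays are linearly independent). A set $X\subseteq E_{nd}$ is dependent if $\lambda_e=\lambda_f$ for all $e,f\in X$ and all $\lambda\in\mathbb{DC}(\mathcal F)$. For $X\subseteq E$, $\mathbb 1_X\in\mathbb R^E$ is its characteristic vector. A set $X\subseteq E_{nd}$ is contractible if $\mathbb 1_{E_{nd}\setminus X}\in\mathbb{DC}(\mathcal F)$ (equivalently $\mathbb 1_X\in\mathbb{DC}(\mathcal F)$), and then $\mathcal F_X$ denotes the deformation of $\mathcal F$ with edge-deformation vector $\mathbb 1_X$. $\mathcal F$ is edge decomposable if $E_{nd}$ can be partitioned into non-empty contractible dependent sets of edges.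
   Formalization: Indecomposability of the F_{C_i} is claimed only for connected F (false otherwise by convention); uniqueness is among decompositions into deformations of F, ignoring summands with empty support and up to translating connected components. *)

theory Defs
  imports "HOL-Analysis.Analysis" "HOL-Library.Disjoint_Sets"
begin

(* A framework is a triple (V, E, \<phi>). Vertices are taken from a finite type, and vectors
   indexed by E are represented in real ^ ('v set) with zero coordinates outside E. Only the
   values of \<phi> on V are relevant. *)

definition framework :: "'v::finite set \<Rightarrow> 'v set set \<Rightarrow> ('v \<Rightarrow> real ^ 'd) \<Rightarrow> bool" where
  "framework V E \<phi> \<longleftrightarrow> finite V \<and> E \<subseteq> {e. e \<subseteq> V \<and> card e = 2}"

definition joined :: "'v set set \<Rightarrow> 'v \<Rightarrow> 'v \<Rightarrow> bool" where
  "joined E u v \<longleftrightarrow> (u, v) \<in> {(x, y). {x, y} \<in> E}\<^sup>*"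

definition connected_graph :: "'v set \<Rightarrow> 'v set set \<Rightarrow> bool" where
  "connected_graph V E \<longleftrightarrow> (\<forall>u\<in>V. \<forall>v\<in>V. joined E u v)"

definition nondeg_edges :: "'v set set \<Rightarrow> ('v \<Rightarrow> real ^ 'd) \<Rightarrow> 'v set set" where
  "nondeg_edges E \<phi> = {e \<in> E. \<exists>u v. e = {u, v} \<and> \<phi> u \<noteq> \<phi> v}"

definition deformation :: "'v set set \<Rightarrow> ('v \<Rightarrow> real ^ 'd) \<Rightarrow> ('v \<Rightarrow> real ^ 'd) \<Rightarrow> bool" where
  "deformation E \<phi> \<psi> \<longleftrightarrow>
     (\<forall>u v. {u, v} \<in> E \<longrightarrow> (\<exists>l\<ge>0. \<psi> v - \<psi> u = l *\<^sub>R (\<phi> v - \<phi> u)))"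

definition edge_deformation_vector ::
  "'v::finite set set \<Rightarrow> ('v \<Rightarrow> real ^ 'd) \<Rightarrow> ('v \<Rightarrow> real ^ 'd) \<Rightarrow> real ^ ('v set)" where
  "edge_deformation_vector E \<phi> \<psi> =
     (\<chi> e. if e \<in> nondeg_edges E \<phi>
           then (THE l. \<forall>u v. e = {u, v} \<longrightarrow> \<psi> v - \<psi> u = l *\<^sub>R (\<phi> v - \<phi> u))
           else 0)"

definition deformation_cone ::
  "'v::finite set set \<Rightarrow> ('v \<Rightarrow> real ^ 'd) \<Rightarrow> (real ^ ('v set)) set" where
  "deformation_cone E \<phi> = {edge_deformation_vector E \<phi> \<psi> |\<psi>. deformation E \<phi> \<psi>}"

definition indecomposable :: "'v set \<Rightarrow> 'v set set \<Rightarrow> ('v \<Rightarrow> real ^ 'd) \<Rightarrow> bool" where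
  "indecomposable V E \<phi> \<longleftrightarrow> connected_graph V E \<and>
     (\<forall>\<psi>. deformation E \<phi> \<psi> \<longrightarrow> (\<exists>\<alpha>\<ge>0. \<exists>t. \<forall>v\<in>V. \<psi> v = \<alpha> *\<^sub>R \<phi> v + t))"

definition rays :: "'a::euclidean_space set \<Rightarrow> 'a set set" where
  "rays C = {R. R face_of C \<and> aff_dim R = 1}"

(* Linear independence of the rays means that of any choice of one non-zero vector per ray. *)
definition simplicial_cone :: "'a::euclidean_space set \<Rightarrow> bool" where
  "simplicial_cone C \<longleftrightarrow>
     polyhedron C \<and> convex_cone C \<and> (\<forall>x\<in>C. - x \<in> C \<longrightarrow> x = 0) \<and>
     (\<forall>g. (\<forall>R\<in>rays C. g R \<in> R \<and> g R \<noteq> 0) \<longrightarrow> independent (g ` rays C))"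

definition uniquely_decomposable :: "'v::finite set set \<Rightarrow> ('v \<Rightarrow> real ^ 'd) \<Rightarrow> bool" where
  "uniquely_decomposable E \<phi> \<longleftrightarrow> simplicial_cone (deformation_cone E \<phi>)"

definition dependent_edges ::
  "'v::finite set set \<Rightarrow> ('v \<Rightarrow> real ^ 'd) \<Rightarrow> 'v set set \<Rightarrow> bool" where
  "dependent_edges E \<phi> X \<longleftrightarrow> X \<subseteq> nondeg_edges E \<phi> \<and>
     (\<forall>e\<in>X. \<forall>f\<in>X. \<forall>l\<in>deformation_cone E \<phi>. l $ e = l $ f)"

definition char_vec :: "'v::finite set set \<Rightarrow> real ^ ('v set)" where
  "char_vec X = (\<chi> e. if e \<in> X then 1 else 0)"

definition contractible_edges ::
  "'v::finite set set \<Rightarrow> ('v \<Rightarrow> real ^ 'd) \<Rightarrow> 'v set set \<Rightarrow> bool" where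
  "contractible_edges E \<phi> X \<longleftrightarrow> X \<subseteq> nondeg_edges E \<phi> \<and>
     char_vec (nondeg_edges E \<phi> - X) \<in> deformation_cone E \<phi>"

(* The condition on \<psi> that it be (a representative of) the framework F_X; the edge-deformation
   vector determines \<psi> only up to translation of the connected components. *)
definition framework_of_edges ::
  "'v::finite set set \<Rightarrow> ('v \<Rightarrow> real ^ 'd) \<Rightarrow> 'v set set \<Rightarrow> ('v \<Rightarrow> real ^ 'd) \<Rightarrow> bool" where
  "framework_of_edges E \<phi> X \<psi> \<longleftrightarrow>
     deformation E \<phi> \<psi> \<and> edge_deformation_vector E \<phi> \<psi> = char_vec X"

definition contractible_dependent_partition ::
  "'v::finite set set \<Rightarrow> ('v \<Rightarrow> real ^ 'd) \<Rightarrow> 'v set set set \<Rightarrow> bool" where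
  "contractible_dependent_partition E \<phi> \<C> \<longleftrightarrow>
     partition_on (nondeg_edges E \<phi>) \<C> \<and>
     (\<forall>X\<in>\<C>. contractible_edges E \<phi> X \<and> dependent_edges E \<phi> X)"

definition edge_decomposable :: "'v::finite set set \<Rightarrow> ('v \<Rightarrow> real ^ 'd) \<Rightarrow> bool" where
  "edge_decomposable E \<phi> \<longleftrightarrow> (\<exists>\<C>. contractible_dependent_partition E \<phi> \<C>)"

(* Equality up to translation of the connected components; if the graph is connected, this is
   equality up to a single translation. *)
definition translation_equiv ::
  "'v set \<Rightarrow> 'v set set \<Rightarrow> ('v \<Rightarrow> real ^ 'd) \<Rightarrow> ('v \<Rightarrow> real ^ 'd) \<Rightarrow> bool" where
  "translation_equiv V E \<phi> \<psi> \<longleftrightarrow>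
     (\<exists>t. (\<forall>u\<in>V. \<forall>v\<in>V. joined E u v \<longrightarrow> t u = t v) \<and> (\<forall>v\<in>V. \<psi> v = \<phi> v + t v))"

(* The summands are required to be deformations: an arbitrary framework on the same graph is
   always a summand, as \<phi> = \<psi> + (\<phi> - \<psi>). *)
definition decomposition ::
  "'v set \<Rightarrow> 'v set set \<Rightarrow> ('v \<Rightarrow> real ^ 'd) \<Rightarrow> 'i set \<Rightarrow> ('i \<Rightarrow> 'v \<Rightarrow> real ^ 'd) \<Rightarrow> bool" where
  "decomposition V E \<phi> J \<psi> \<longleftrightarrow> finite J \<and> (\<forall>j\<in>J. deformation E \<phi> (\<psi> j)) \<and>
     translation_equiv V E (\<lambda>v. \<Sum>j\<in>J. \<psi> j v) \<phi>"

definition distinct_supports ::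
  "'v set set \<Rightarrow> 'i set \<Rightarrow> ('i \<Rightarrow> 'v \<Rightarrow> real ^ 'd) \<Rightarrow> bool" where
  "distinct_supports E J \<psi> \<longleftrightarrow> inj_on (\<lambda>j. nondeg_edges E (\<psi> j)) J"

(* A summand without non-degenerate edges only contributes a translation. Decompositions being
   considered up to translation, such summands are disregarded here. *)
definition same_decomposition ::
  "'v set \<Rightarrow> 'v set set \<Rightarrow> 'i set \<Rightarrow> ('i \<Rightarrow> 'v \<Rightarrow> real ^ 'd) \<Rightarrow>
   'k set \<Rightarrow> ('k \<Rightarrow> 'v \<Rightarrow> real ^ 'd) \<Rightarrow> bool" where
  "same_decomposition V E J \<psi> K \<omega> \<longleftrightarrow>
     (\<exists>\<sigma>. bij_betw \<sigma> {j\<in>J. nondeg_edges E (\<psi> j) \<noteq> {}} {k\<in>K. nondeg_edges E (\<omega> k) \<noteq> {}} \<and>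
          (\<forall>j\<in>J. nondeg_edges E (\<psi> j) \<noteq> {} \<longrightarrow> translation_equiv V E (\<psi> j) (\<omega> (\<sigma> j))))"

end

theory Submission
  imports Defs
begin

text \<open>
  Contractibility of a class \<open>C\<close> of the partition gives \<open>char_vec C\<close> as the edge-deformation vector of
  \<open>\<phi> - \<psi>\<close>, where \<open>\<psi>\<close> is the deformation contracting \<open>C\<close>; dependence makes every edge-deformation vector constant on
  each class. So the deformation cone is generated by the characteristic vectors of the
  classes, which are linearly independent because the classes are disjoint and non-empty.
  If a deformation \<open>\<psi>\<close> is indecomposable and its vector is positive on a class \<open>C\<close>, then
  \<open>F\<^sub>C\<close> is a deformation of \<open>\<psi>\<close> and hence a multiple of it, so the vector of \<open>\<psi>\<close> is a multiple of
  \<open>char_vec C\<close>. Summands with distinct supports then belong to distinct classes, and comparing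
  the sum of the vectors with that of \<open>\<phi>\<close> forces all multiples to be \<open>1\<close>.
\<close>

section \<open>Cones generated by linearly independent vectors\<close>

lemma convex_cone_sum:
  assumes "convex_cone K" "\<And>i. i \<in> I \<Longrightarrow> f i \<in> K"
  shows "sum f I \<in> K"
  using assms(2)
  by (induction I rule: infinite_finite_induct)
    (simp_all add: assms(1) convex_cone_add convex_cone_contains_0)

text \<open>Puts a multiple of one generator in the form of a combination over all of
  \<open>B\<close>, so that its coefficients can be compared by
  \<open>independent_sum_cong\<close>.\<close>

lemma sum_scaleR_single:
  fixes B :: "'a::real_vector set"
  assumes "finite B" "b \<in> B"
  shows "(\<Sum>x\<in>B. (if x = b then t else 0) *\<^sub>R x) = t *\<^sub>R b"
proof -
  have "(\<Sum>x\<in>B. (if x = b then t else 0) *\<^sub>R x) = (\<Sum>x\<in>B. if x = b then t *\<^sub>R b else 0)"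
    by (intro sum.cong) auto
  then show ?thesis
    using assms by simp
qed

text \<open>Turns membership in the hull into a choice of non-negative coefficients. The set of such
  combinations is itself a convex cone containing \<open>B\<close>, so minimality of the hull gives
  the inclusion that is not immediate.\<close>

lemma convex_cone_hull_finite:
  fixes B :: "'a::real_vector set"
  assumes "finite B"
  shows "convex_cone hull B = {\<Sum>b\<in>B. c b *\<^sub>R b |c. \<forall>b\<in>B. 0 \<le> c b}" (is "_ = ?K")
proof
  have "b \<in> ?K" if "b \<in> B" for b
    using sum_scaleR_single[OF assms that, of 1]
    by (intro CollectI exI[of _ "\<lambda>x. if x = b then 1 else 0"]) simp
  moreover have "convex_cone ?K"
    unfolding convex_cone_iff
  proof (intro conjI ballI allI impI)
    show "0 \<in> ?K"
      by (auto intro!: exI[of _ "\<lambda>_. 0"])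
  next
    fix x y assume "x \<in> ?K" "y \<in> ?K"
    then obtain c d where c: "x = (\<Sum>b\<in>B. c b *\<^sub>R b)" "\<forall>b\<in>B. 0 \<le> c b"
      and d: "y = (\<Sum>b\<in>B. d b *\<^sub>R b)" "\<forall>b\<in>B. 0 \<le> d b"
      by blast
    show "x + y \<in> ?K"
      using c d by (auto intro!: exI[of _ "\<lambda>b. c b + d b"] simp: scaleR_add_left sum.distrib)
  next
    fix x r assume "x \<in> ?K" "(0::real) \<le> r"
    then obtain c where c: "x = (\<Sum>b\<in>B. c b *\<^sub>R b)" "\<forall>b\<in>B. 0 \<le> c b"
      by blast
    show "r *\<^sub>R x \<in> ?K"
      using c \<open>0 \<le> r\<close> by (auto intro!: exI[of _ "\<lambda>b. r * c b"] simp: scaleR_sum_right)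
  qed
  ultimately show "convex_cone hull B \<subseteq> ?K"
    by (intro hull_minimal) auto
next
  show "?K \<subseteq> convex_cone hull B"
    by (auto intro!: convex_cone_sum convex_cone_convex_cone_hull convex_cone_hull_mul
        simp: hull_inc)
qed

lemma independent_sum_cong:
  assumes "independent B" "finite B" "(\<Sum>b\<in>B. c b *\<^sub>R b) = (\<Sum>b\<in>B. d b *\<^sub>R b)" "b \<in> B"
  shows "c b = d b"
proof -
  have "(\<Sum>b\<in>B. (c b - d b) *\<^sub>R b) = 0"
    using assms(3) by (simp add: scaleR_diff_left sum_subtractf)
  then show ?thesis
    using independentD[OF assms(1,2) subset_refl, of "\<lambda>b. c b - d b"] assms(4) by simp
qed

lemma conic_hull_singleton: "conic hull {b} = {t *\<^sub>R b |t. 0 \<le> t}"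
  by (auto simp: conic_hull_explicit)

lemma aff_dim_conic_hull_singleton:
  fixes b :: "'a::euclidean_space"
  assumes "b \<noteq> 0"
  shows "aff_dim (conic hull {b}) = 1"
proof -
  have "dim (conic hull {b}) = 1"
    by (rule dim_unique[where B = "{b}"])
      (auto simp: conic_hull_singleton assms span_base span_scale intro: exI[of _ 1])
  then show ?thesis
    by (simp add: aff_dim_zero hull_inc)
qed

text \<open>If two generators spanned the same ray, each would be a multiple of the other, against
  independence. This makes different classes give different rays.\<close>

lemma inj_on_conic_hull:
  assumes "independent B"
  shows "inj_on (\<lambda>b. conic hull {b}) B"
proof (rule inj_onI, rule ccontr)
  fix a b assume "a \<in> B" "b \<in> B" "conic hull {a} = conic hull {b}" "a \<noteq> b"
  then obtain t where "a = t *\<^sub>R b"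
    using hull_inc[of a "{a}" conic] by (auto simp: conic_hull_singleton)
  then have "a \<in> span (B - {a})"
    using \<open>b \<in> B\<close> \<open>a \<noteq> b\<close> by (metis DiffI singletonD span_base span_scale)
  then show False
    using assms \<open>a \<in> B\<close> by (auto simp: dependent_def)
qed

text \<open>Serves the last clause of \<open>simplicial_cone\<close>: choosing a non-zero vector on
  every ray amounts to rescaling the generators by non-zero factors.\<close>

lemma independent_rescale:
  assumes "independent B" "finite B" "\<And>b. b \<in> B \<Longrightarrow> c b \<noteq> 0"
  shows "independent ((\<lambda>b. c b *\<^sub>R b) ` B)"
proof -
  \<comment> \<open>Independence concerns the image as a set, so the sum over it can be pulled back
    to \<open>B\<close> only once the rescaled vectors are known to be distinct.\<close>
  have inj: "inj_on (\<lambda>b. c b *\<^sub>R b) B"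
  proof (rule inj_onI, rule ccontr)
    fix a b assume ab: "a \<in> B" "b \<in> B" "c a *\<^sub>R a = c b *\<^sub>R b" "a \<noteq> b"
    then have "inverse (c a) *\<^sub>R (c a *\<^sub>R a) = inverse (c a) *\<^sub>R (c b *\<^sub>R b)"
      by simp
    then have "a = (inverse (c a) * c b) *\<^sub>R b"
      using assms(3)[OF ab(1)] by simp
    then have "a \<in> span (B - {a})"
      using span_scale[OF span_base, of b "B - {a}"] ab(2,4) by (metis DiffI singletonD)
    then show False
      using assms(1) \<open>a \<in> B\<close> by (auto simp: dependent_def)
  qed
  show ?thesis
  proof (rule independent_if_scalars_zero)
    fix f x
    assume sum0: "(\<Sum>x\<in>(\<lambda>b. c b *\<^sub>R b) ` B. f x *\<^sub>R x) = 0" and "x \<in> (\<lambda>b. c b *\<^sub>R b) ` B"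
    then obtain b where b: "b \<in> B" "x = c b *\<^sub>R b"
      by blast
    have "(\<Sum>b\<in>B. (f (c b *\<^sub>R b) * c b) *\<^sub>R b) = 0"
      using sum0 by (simp add: sum.reindex[OF inj])
    then have "f (c b *\<^sub>R b) * c b = 0"
      using independentD[OF assms(1,2) subset_refl, of "\<lambda>b. f (c b *\<^sub>R b) * c b"] b(1) by simp
    then show "f x = 0"
      using assms(3) b by simp
  qed (simp add: assms(2))
qed

text \<open>A point inside a segment is a combination of both endpoints with strictly positive
  weights. If it lies on the ray of \<open>b\<close>, its coefficients away from \<open>b\<close>
  vanish; being sums of non-negative terms, they vanish for both endpoints too.\<close>

lemma conic_hull_face_of_convex_cone_hull:
  fixes B :: "'a::euclidean_space set"
  assumes "independent B" "b \<in> B"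
  shows "conic hull {b} face_of convex_cone hull B"
  unfolding face_of_def
proof (intro conjI ballI impI)
  have fin: "finite B"
    using assms(1) by (rule finiteI_independent)
  show "conic hull {b} \<subseteq> convex_cone hull B"
    by (intro hull_minimal conic_convex_cone_hull) (simp add: assms(2) hull_inc)
  show "convex (conic hull {b})"
    by (simp add: convex_conic_hull)
  fix y z x
  assume "y \<in> convex_cone hull B" "z \<in> convex_cone hull B" and x: "x \<in> conic hull {b}"
    and seg: "x \<in> open_segment y z"
  then obtain c d where c: "y = (\<Sum>b\<in>B. c b *\<^sub>R b)" "\<forall>b\<in>B. 0 \<le> c b"
      and d: "z = (\<Sum>b\<in>B. d b *\<^sub>R b)" "\<forall>b\<in>B. 0 \<le> d b"
    unfolding convex_cone_hull_finite[OF fin] by blast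
  obtain t where t: "x = t *\<^sub>R b"
    using x by (auto simp: conic_hull_singleton)
  obtain u where u: "0 < u" "u < 1" "x = (1 - u) *\<^sub>R y + u *\<^sub>R z"
    using seg by (auto simp: in_segment)
  have "(\<Sum>a\<in>B. ((1 - u) * c a + u * d a) *\<^sub>R a) = (\<Sum>a\<in>B. (if a = b then t else 0) *\<^sub>R a)"
    unfolding sum_scaleR_single[OF fin assms(2)] t[symmetric] u(3) c(1) d(1)
    by (simp add: scaleR_add_left sum.distrib scaleR_sum_right)
  then have eq: "(1 - u) * c a + u * d a = (if a = b then t else 0)" if "a \<in> B" for a
    using independent_sum_cong[OF assms(1) fin, of "\<lambda>a. (1 - u) * c a + u * d a"
        "\<lambda>a. if a = b then t else 0" a] that by blast
  have zero: "c a = 0 \<and> d a = 0" if "a \<in> B" "a \<noteq> b" for a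
  proof -
    have "(1 - u) * c a \<ge> 0" "u * d a \<ge> 0"
      using u c(2) d(2) that by simp_all
    moreover have "(1 - u) * c a + u * d a = 0"
      using eq[OF that(1)] that(2) by simp
    ultimately have "(1 - u) * c a = 0" "u * d a = 0"
      by linarith+
    then show ?thesis
      using u by simp
  qed
  have "y = c b *\<^sub>R b" "z = d b *\<^sub>R b"
    unfolding c(1) d(1) using zero
    by (auto simp: sum_scaleR_single[OF fin assms(2), symmetric] intro!: sum.cong)
  then show "y \<in> conic hull {b}" "z \<in> conic hull {b}"
    using c(2) d(2) assms(2) by (auto simp: conic_hull_singleton)
qed

text \<open>The point \<open>x + y\<close> is the midpoint of \<open>2 *\<^sub>R x\<close> and
  \<open>2 *\<^sub>R y\<close>, so the face contains these endpoints, and a face of a cone is conic.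
  An open segment needs distinct endpoints, hence the separate case \<open>x = y\<close>.\<close>

lemma face_of_convex_cone_split:
  assumes K: "convex_cone K" and F: "F face_of K" and "x \<in> K" "y \<in> K" "x + y \<in> F"
  shows "x \<in> F"
proof -
  have "conic F"
    using face_of_conic[OF _ F] K by (simp add: convex_cone_def)
  have "2 *\<^sub>R x \<in> F"
  proof (cases "x = y")
    case True
    then show ?thesis
      using assms(5) by (simp add: scaleR_2)
  next
    case False
    have "x + y = (1 - 1/2) *\<^sub>R (2 *\<^sub>R x) + (1/2) *\<^sub>R (2 *\<^sub>R y)"
      by simp
    then have "x + y \<in> open_segment (2 *\<^sub>R x) (2 *\<^sub>R y)"
      unfolding in_segment using False by (intro conjI exI[of _ "1/2"]) auto
    then show ?thesis
      using face_ofD[OF F _ _ _ \<open>x + y \<in> F\<close>] assms(3,4) convex_cone_scaleR[OF K, of 2] by auto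
  qed
  then show ?thesis
    using conicD[OF \<open>conic F\<close>, of "2 *\<^sub>R x" "1/2"] by simp
qed

text \<open>A ray \<open>R\<close> contains a non-zero conic combination of generators. Splitting
  off one non-zero term shows that \<open>R\<close> contains a generator \<open>b\<close>, and
  comparing dimensions identifies \<open>R\<close> with the ray of \<open>b\<close>.\<close>

lemma rays_convex_cone_hull:
  fixes B :: "'a::euclidean_space set"
  assumes "independent B"
  shows "rays (convex_cone hull B) = (\<lambda>b. conic hull {b}) ` B"
proof
  have fin: "finite B"
    using assms by (rule finiteI_independent)
  have nz: "b \<noteq> 0" if "b \<in> B" for b
    using assms that dependent_zero by blast
  then show "(\<lambda>b. conic hull {b}) ` B \<subseteq> rays (convex_cone hull B)"
    by (auto simp: rays_def conic_hull_face_of_convex_cone_hull[OF assms]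
        aff_dim_conic_hull_singleton)
  let ?K = "convex_cone hull B"
  show "rays ?K \<subseteq> (\<lambda>b. conic hull {b}) ` B"
  proof
    fix R assume "R \<in> rays ?K"
    then have R: "R face_of ?K" and dim1: "aff_dim R = 1"
      by (auto simp: rays_def)
    have KR: "convex_cone ?K"
      by (rule convex_cone_convex_cone_hull)
    have RK: "R \<subseteq> ?K"
      using R by (rule face_of_imp_subset)
    have "\<not> R \<subseteq> {0}"
      using aff_dim_subset[of R "{0}"] dim1 by auto
    then obtain x where x: "x \<in> R" "x \<noteq> 0"
      by blast
    have "conic R"
      using face_of_conic[OF _ R] KR by (simp add: convex_cone_def)
    obtain c where c: "x = (\<Sum>b\<in>B. c b *\<^sub>R b)" "\<forall>b\<in>B. 0 \<le> c b"
      using x(1) RK unfolding convex_cone_hull_finite[OF fin] by blast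
    obtain b where b: "b \<in> B" "c b \<noteq> 0"
      using x(2) c(1) by (metis (no_types, lifting) scaleR_zero_left sum.neutral)
    have "x = c b *\<^sub>R b + (\<Sum>b\<in>B - {b}. c b *\<^sub>R b)"
      using c(1) b(1) fin by (simp add: sum.remove)
    moreover have "c b *\<^sub>R b \<in> ?K" "(\<Sum>b\<in>B - {b}. c b *\<^sub>R b) \<in> ?K"
      using c(2) b(1) by (auto intro!: convex_cone_sum[OF KR] convex_cone_hull_mul simp: hull_inc)
    ultimately have "c b *\<^sub>R b \<in> R"
      using face_of_convex_cone_split[OF KR R] x(1) by metis
    then have bR: "b \<in> R"
      using conicD[OF \<open>conic R\<close>, of "c b *\<^sub>R b" "inverse (c b)"] b c(2) by simp
    then have sub: "conic hull {b} \<subseteq> R"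
      using \<open>conic R\<close> by (simp add: hull_minimal)
    have "conic hull {b} face_of R"
      using conic_hull_face_of_convex_cone_hull[OF assms b(1)] face_of_subset RK sub by blast
    moreover have "convex R"
      using R face_of_imp_convex by blast
    \<comment> \<open>A proper face of a convex set has strictly smaller affine dimension, but both
      dimensions are 1 here.\<close>
    ultimately have "conic hull {b} = R"
      using face_of_aff_dim_lt[of R "conic hull {b}"] dim1
        aff_dim_conic_hull_singleton[OF nz[OF b(1)]] by auto
    then show "R \<in> (\<lambda>b. conic hull {b}) ` B"
      using b(1) by blast
  qed
qed

lemma dim_convex_cone_hull:
  fixes B :: "'a::euclidean_space set"
  assumes "independent B"
  shows "dim (convex_cone hull B) = card B"
  using assms
  by (intro dim_unique) (auto simp: hull_subset hull_minimal convex_cone_span span_superset)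

lemma simplicial_cone_convex_cone_hull:
  fixes B :: "'a::euclidean_space set"
  assumes "independent B"
  shows "simplicial_cone (convex_cone hull B)"
  unfolding simplicial_cone_def
proof (intro conjI ballI impI allI)
  have fin: "finite B"
    using assms by (rule finiteI_independent)
  show "polyhedron (convex_cone hull B)"
    using fin by (rule polyhedron_convex_cone_hull)
  show "convex_cone (convex_cone hull B)"
    by (rule convex_cone_convex_cone_hull)
  show "x = 0" if "x \<in> convex_cone hull B" "- x \<in> convex_cone hull B" for x
  proof -
    obtain c d where c: "x = (\<Sum>b\<in>B. c b *\<^sub>R b)" "\<forall>b\<in>B. 0 \<le> c b"
      and d: "- x = (\<Sum>b\<in>B. d b *\<^sub>R b)" "\<forall>b\<in>B. 0 \<le> d b"
      using \<open>x \<in> _\<close> \<open>- x \<in> _\<close> unfolding convex_cone_hull_finite[OF fin] by blast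
    \<comment> \<open>Pointedness: the coefficients of \<open>x\<close> are the negatives of those
      of \<open>- x\<close>, and both families are non-negative.\<close>
    have "(\<Sum>b\<in>B. c b *\<^sub>R b) = (\<Sum>b\<in>B. (- d b) *\<^sub>R b)"
      by (simp add: sum_negf c(1)[symmetric] d(1)[symmetric])
    then have "c b = - d b" if "b \<in> B" for b
      using independent_sum_cong[OF assms fin _ that, of c "\<lambda>b. - d b"] by simp
    then have "c b = 0" if "b \<in> B" for b
      using c(2) d(2) that by force
    then show ?thesis
      using c(1) by simp
  qed
  fix g assume g: "\<forall>R\<in>rays (convex_cone hull B). g R \<in> R \<and> g R \<noteq> 0"
  have "\<forall>b\<in>B. \<exists>t. t \<noteq> 0 \<and> g (conic hull {b}) = t *\<^sub>R b"
    using g by (fastforce simp: rays_convex_cone_hull[OF assms] conic_hull_singleton)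
  then obtain t where t: "\<And>b. b \<in> B \<Longrightarrow> t b \<noteq> 0 \<and> g (conic hull {b}) = t b *\<^sub>R b"
    by metis
  then have "g ` rays (convex_cone hull B) = (\<lambda>b. t b *\<^sub>R b) ` B"
    by (simp add: rays_convex_cone_hull[OF assms] image_image)
  then show "independent (g ` rays (convex_cone hull B))"
    using independent_rescale[OF assms fin] t by simp
qed

section \<open>Deformations of frameworks\<close>

text \<open>Combines being a deformation with having \<open>l\<close> as its vector, in conditions
  that avoid \<open>THE\<close> and behave well under sums and non-negative multiples.\<close>

definition deforms_with ::
  "'v::finite set set \<Rightarrow> ('v \<Rightarrow> real ^ 'd) \<Rightarrow> real ^ ('v set) \<Rightarrow> ('v \<Rightarrow> real ^ 'd) \<Rightarrow> bool" where
  "deforms_with E \<phi> l \<psi> \<longleftrightarrow>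
     (\<forall>e. 0 \<le> l $ e) \<and> (\<forall>e. e \<notin> nondeg_edges E \<phi> \<longrightarrow> l $ e = 0) \<and>
     (\<forall>u v. {u, v} \<in> E \<longrightarrow> \<psi> v - \<psi> u = l $ {u, v} *\<^sub>R (\<phi> v - \<phi> u))"

lemma nondeg_edges_iff: "{u, v} \<in> nondeg_edges E \<phi> \<longleftrightarrow> {u, v} \<in> E \<and> \<phi> u \<noteq> \<phi> v"
  by (auto simp: nondeg_edges_def doubleton_eq_iff)

lemma nondeg_edges_cases:
  assumes "e \<in> nondeg_edges E \<phi>"
  obtains u v where "e = {u, v}" "{u, v} \<in> E" "\<phi> u \<noteq> \<phi> v"
  using assms by (auto simp: nondeg_edges_def)

lemma edge_deformation_vector_nth:
  assumes "{u, v} \<in> nondeg_edges E \<phi>" "\<psi> v - \<psi> u = l *\<^sub>R (\<phi> v - \<phi> u)"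
  shows "edge_deformation_vector E \<phi> \<psi> $ {u, v} = l"
proof -
  have ne: "\<phi> v - \<phi> u \<noteq> 0"
    using assms(1) by (auto simp: nondeg_edges_iff)
  \<comment> \<open>The description under \<open>THE\<close> ranges over both orderings of the edge,
    so the reversed equation is needed as well; uniqueness of the factor comes from
    \<open>ne\<close>.\<close>
  have "\<psi> u - \<psi> v = l *\<^sub>R (\<phi> u - \<phi> v)"
    using arg_cong[OF assms(2), of uminus] by (simp add: scaleR_minus_right[symmetric])
  then have "(THE l. \<forall>x y. {u, v} = {x, y} \<longrightarrow> \<psi> y - \<psi> x = l *\<^sub>R (\<phi> y - \<phi> x)) = l"
    using assms(2) ne by (intro the_equality) (auto simp: doubleton_eq_iff)
  then show ?thesis
    using assms(1) by (simp add: edge_deformation_vector_def)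
qed

lemma deforms_with_iff:
  "deforms_with E \<phi> l \<psi> \<longleftrightarrow> deformation E \<phi> \<psi> \<and> edge_deformation_vector E \<phi> \<psi> = l"
proof
  assume l: "deforms_with E \<phi> l \<psi>"
  have "edge_deformation_vector E \<phi> \<psi> $ e = l $ e" for e
  proof (cases "e \<in> nondeg_edges E \<phi>")
    case True
    then obtain u v where "e = {u, v}" "{u, v} \<in> E" "\<phi> u \<noteq> \<phi> v"
      by (rule nondeg_edges_cases)
    then show ?thesis
      using l True by (auto simp: deforms_with_def intro: edge_deformation_vector_nth)
  next
    case False
    then show ?thesis
      using l by (simp add: deforms_with_def edge_deformation_vector_def)
  qed
  then show "deformation E \<phi> \<psi> \<and> edge_deformation_vector E \<phi> \<psi> = l"
    using l by (auto simp: deforms_with_def deformation_def vec_eq_iff)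
next
  assume "deformation E \<phi> \<psi> \<and> edge_deformation_vector E \<phi> \<psi> = l"
  then have def: "deformation E \<phi> \<psi>" and l: "l = edge_deformation_vector E \<phi> \<psi>"
    by simp_all
  have nonneg: "0 \<le> l $ e" if e: "e \<in> nondeg_edges E \<phi>" for e
  proof -
    obtain u v where uv: "e = {u, v}" "{u, v} \<in> E" "\<phi> u \<noteq> \<phi> v"
      using e by (rule nondeg_edges_cases)
    obtain r where "0 \<le> r" "\<psi> v - \<psi> u = r *\<^sub>R (\<phi> v - \<phi> u)"
      using def uv(2) by (auto simp: deformation_def)
    then show ?thesis
      using edge_deformation_vector_nth[of u v E \<phi> \<psi> r] e uv(1) l by simp
  qed
  have zero: "l $ e = 0" if "e \<notin> nondeg_edges E \<phi>" for e
    using that by (simp add: l edge_deformation_vector_def)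
  have "\<psi> v - \<psi> u = l $ {u, v} *\<^sub>R (\<phi> v - \<phi> u)" if uv: "{u, v} \<in> E" for u v
  proof -
    obtain r where r: "\<psi> v - \<psi> u = r *\<^sub>R (\<phi> v - \<phi> u)"
      using def uv by (auto simp: deformation_def)
    show ?thesis
    \<comment> \<open>On a degenerate edge both sides are zero, which agrees with the default
      coordinate 0 of the vector.\<close>
    proof (cases "\<phi> u = \<phi> v")
      case False
      then show ?thesis
        using edge_deformation_vector_nth[of u v E \<phi> \<psi> r] r uv l by (simp add: nondeg_edges_iff)
    qed (use r in simp)
  qed
  then show "deforms_with E \<phi> l \<psi>"
    using nonneg zero by (auto simp: deforms_with_def) (metis order_refl)
qed

lemma deformation_cone_iff: "l \<in> deformation_cone E \<phi> \<longleftrightarrow> (\<exists>\<psi>. deforms_with E \<phi> l \<psi>)"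
  by (auto simp: deformation_cone_def deforms_with_iff)

lemma convex_cone_deformation_cone:
  fixes E :: "'v::finite set set" and \<phi> :: "'v \<Rightarrow> real ^ 'd"
  shows "convex_cone (deformation_cone E \<phi>)"
  unfolding convex_cone_iff
proof (intro conjI ballI allI impI)
  show "0 \<in> deformation_cone E \<phi>"
    unfolding deformation_cone_iff
    by (intro exI[of _ "\<lambda>_. 0"]) (simp add: deforms_with_def)
next
  fix l m assume "l \<in> deformation_cone E \<phi>" "m \<in> deformation_cone E \<phi>"
  then obtain \<psi> \<eta> where "deforms_with E \<phi> l \<psi>" "deforms_with E \<phi> m \<eta>"
    by (auto simp: deformation_cone_iff)
  then have "deforms_with E \<phi> (l + m) (\<lambda>v. \<psi> v + \<eta> v)"
    by (simp add: deforms_with_def add_diff_add scaleR_add_left)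
  then show "l + m \<in> deformation_cone E \<phi>"
    by (auto simp: deformation_cone_iff)
next
  fix l and c :: real assume "l \<in> deformation_cone E \<phi>" "0 \<le> c"
  then obtain \<psi> where "deforms_with E \<phi> l \<psi>"
    by (auto simp: deformation_cone_iff)
  then have "deforms_with E \<phi> (c *\<^sub>R l) (\<lambda>v. c *\<^sub>R \<psi> v)"
    using \<open>0 \<le> c\<close> by (simp add: deforms_with_def scaleR_diff_right[symmetric])
  then show "c *\<^sub>R l \<in> deformation_cone E \<phi>"
    by (auto simp: deformation_cone_iff)
qed

text \<open>Lets supports be read off from vectors. An edge degenerate in \<phi> has coordinate 0,
  so on the remaining edges only a zero factor can collapse it in \<psi>.\<close>

lemma nondeg_edges_deformation:
  assumes "deforms_with E \<phi> l \<psi>"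
  shows "nondeg_edges E \<psi> = {e. l $ e \<noteq> 0}"
proof (intro equalityI subsetI CollectI)
  fix e assume "e \<in> nondeg_edges E \<psi>"
  then obtain u v where uv: "e = {u, v}" "{u, v} \<in> E" "\<psi> u \<noteq> \<psi> v"
    by (rule nondeg_edges_cases)
  then have "\<psi> v - \<psi> u = l $ e *\<^sub>R (\<phi> v - \<phi> u)"
    using assms by (simp add: deforms_with_def)
  then show "l $ e \<noteq> 0"
    using uv(3) by auto
next
  fix e assume e: "e \<in> {e. l $ e \<noteq> 0}"
  then have "e \<in> nondeg_edges E \<phi>"
    using assms by (auto simp: deforms_with_def)
  then obtain u v where uv: "e = {u, v}" "{u, v} \<in> E" "\<phi> u \<noteq> \<phi> v"
    by (rule nondeg_edges_cases)
  then have "\<psi> v - \<psi> u = l $ e *\<^sub>R (\<phi> v - \<phi> u)"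
    using assms by (simp add: deforms_with_def)
  then have "\<psi> u \<noteq> \<psi> v"
    using e uv(3) by auto
  then show "e \<in> nondeg_edges E \<psi>"
    using uv by (simp add: nondeg_edges_iff)
qed

section \<open>Equality up to translation of the components\<close>

lemma joined_imp_eq:
  assumes "joined E u v" "\<And>u v. {u, v} \<in> E \<Longrightarrow> t u = t v"
  shows "t u = t v"
  using assms(1) unfolding joined_def
  by (induction rule: rtrancl_induct) (auto simp: assms(2))

text \<open>The difference of the two maps is constant along edges, hence along paths, and serves as
  the translation.\<close>

lemma translation_equivI:
  assumes "\<And>u v. {u, v} \<in> E \<Longrightarrow> \<phi> v - \<phi> u = \<psi> v - \<psi> u"
  shows "translation_equiv V E \<phi> \<psi>"
  unfolding translation_equiv_def
proof (intro exI[of _ "\<lambda>v. \<psi> v - \<phi> v"] conjI ballI impI)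
  fix u v assume "joined E u v"
  then show "\<psi> u - \<phi> u = \<psi> v - \<phi> v"
    by (rule joined_imp_eq) (use assms in \<open>simp add: algebra_simps\<close>)
qed simp

lemma translation_equivD:
  assumes "translation_equiv V E \<phi> \<psi>" "{u, v} \<in> E" "u \<in> V" "v \<in> V"
  shows "\<phi> v - \<phi> u = \<psi> v - \<psi> u"
proof -
  have "joined E u v"
    using assms(2) by (auto simp: joined_def)
  then show ?thesis
    using assms by (auto simp: translation_equiv_def)
qed

lemma connected_graph_translationE:
  fixes \<phi> \<psi> :: "'v \<Rightarrow> 'a::ab_group_add"
  assumes "connected_graph V E" "\<And>u v. {u, v} \<in> E \<Longrightarrow> \<phi> v - \<phi> u = \<psi> v - \<psi> u"
  obtains t where "\<And>v. v \<in> V \<Longrightarrow> \<psi> v = \<phi> v + t"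
\<comment> \<open>The single translation is read off at a base vertex \<open>w\<close>, which
  requires a non-empty vertex set.\<close>
proof (cases "V = {}")
  case False
  then obtain w where w: "w \<in> V"
    by blast
  have "\<psi> u - \<phi> u = \<psi> v - \<phi> v" if "{u, v} \<in> E" for u v
    using assms(2)[OF that] by (simp add: algebra_simps)
  then have "\<psi> v - \<phi> v = \<psi> w - \<phi> w" if "v \<in> V" for v
    using joined_imp_eq[of E v w "\<lambda>v. \<psi> v - \<phi> v"] assms(1) w that
    by (simp add: connected_graph_def)
  then show ?thesis
    using that[of "\<psi> w - \<phi> w"] by (simp add: algebra_simps)
qed (use that in simp)

lemma framework_edge_in:
  assumes "framework V E \<phi>" "{u, v} \<in> E"
  shows "u \<in> V" "v \<in> V"
  using assms by (auto simp: framework_def)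

section \<open>Characteristic vectors of classes and the deformation cone\<close>

lemma contractible_edges_char_vec:
  assumes "contractible_edges E \<phi> X"
  shows "char_vec X \<in> deformation_cone E \<phi>"
proof -
  have X: "X \<subseteq> nondeg_edges E \<phi>"
    using assms by (simp add: contractible_edges_def)
  obtain \<psi> where \<psi>: "deforms_with E \<phi> (char_vec (nondeg_edges E \<phi> - X)) \<psi>"
    using assms by (auto simp: contractible_edges_def deformation_cone_iff)
  have "(\<phi> v - \<psi> v) - (\<phi> u - \<psi> u) = char_vec X $ {u, v} *\<^sub>R (\<phi> v - \<phi> u)" if uv: "{u, v} \<in> E" for u v
  proof -
    have \<psi>_diff: "\<psi> v - \<psi> u = char_vec (nondeg_edges E \<phi> - X) $ {u, v} *\<^sub>R (\<phi> v - \<phi> u)"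
      using \<psi> uv by (simp add: deforms_with_def)
    have "(\<phi> v - \<psi> v) - (\<phi> u - \<psi> u) = (\<phi> v - \<phi> u) - (\<psi> v - \<psi> u)"
      by simp
    also have "\<dots> = (1 - char_vec (nondeg_edges E \<phi> - X) $ {u, v}) *\<^sub>R (\<phi> v - \<phi> u)"
      unfolding \<psi>_diff scaleR_diff_left by simp
    \<comment> \<open>A non-degenerate edge lies in exactly one of \<open>X\<close> and its
      complement within the support; on a degenerate edge the factor multiplies zero.\<close>
    also have "\<dots> = char_vec X $ {u, v} *\<^sub>R (\<phi> v - \<phi> u)"
      using uv by (cases "\<phi> u = \<phi> v") (auto simp: char_vec_def nondeg_edges_iff)
    finally show ?thesis .
  qed
  then have "deforms_with E \<phi> (char_vec X) (\<lambda>v. \<phi> v - \<psi> v)"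
    using X by (auto simp: deforms_with_def char_vec_def)
  then show ?thesis
    by (auto simp: deformation_cone_iff)
qed

text \<open>By disjointness only one class contributes at a given edge. Evaluating at an edge thus
  reads off a coefficient, which yields independence, the description of the cone and the
  decomposition of \<phi>.\<close>

lemma sum_char_vec_partition:
  fixes \<C> :: "'v::finite set set set"
  assumes "partition_on N \<C>" "X \<in> \<C>" "e \<in> X"
  shows "(\<Sum>Y\<in>\<C>. c Y *\<^sub>R char_vec Y) $ e = c X"
proof -
  have "e \<in> Y \<longleftrightarrow> Y = X" if "Y \<in> \<C>" for Y
    using assms that by (auto simp: partition_on_def disjoint_def)
  then have "(\<Sum>Y\<in>\<C>. c Y * (if e \<in> Y then 1 else 0)) = (\<Sum>Y\<in>\<C>. if Y = X then c Y else 0)"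
    by (intro sum.cong) simp_all
  then show ?thesis
    using assms(2) by (simp add: char_vec_def)
qed

lemma inj_char_vec: "inj char_vec"
  by (rule injI) (auto simp: char_vec_def vec_eq_iff split: if_splits)

lemma independent_char_vec_partition:
  fixes \<C> :: "'v::finite set set set"
  assumes "partition_on N \<C>"
  shows "independent (char_vec ` \<C>)"
proof (rule independent_if_scalars_zero)
  fix f x assume 0: "(\<Sum>x\<in>char_vec ` \<C>. f x *\<^sub>R x) = 0" and "x \<in> char_vec ` \<C>"
  then obtain X where X: "X \<in> \<C>" "x = char_vec X"
    by blast
  \<comment> \<open>Classes of a partition are non-empty, so each coefficient of a linear relation
    can be isolated at some edge.\<close>
  then obtain e where e: "e \<in> X"
    using assms by (fastforce simp: partition_on_def)
  have "(\<Sum>Y\<in>\<C>. f (char_vec Y) *\<^sub>R char_vec Y) = 0"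
    using 0 by (simp add: sum.reindex[OF inj_on_subset[OF inj_char_vec]])
  then show "f x = 0"
    using sum_char_vec_partition[OF assms X(1) e, of "\<lambda>Y. f (char_vec Y)"] X(2) by simp
qed simp

lemma deformation_cone_coefficients:
  assumes "contractible_dependent_partition E \<phi> \<C>" "l \<in> deformation_cone E \<phi>"
  obtains c where "\<And>X. X \<in> \<C> \<Longrightarrow> 0 \<le> c X" "\<And>X e. X \<in> \<C> \<Longrightarrow> e \<in> X \<Longrightarrow> l $ e = c X"
    "\<And>e. e \<notin> nondeg_edges E \<phi> \<Longrightarrow> l $ e = 0"
proof -
  have part: "partition_on (nondeg_edges E \<phi>) \<C>"
    and dep: "\<And>X. X \<in> \<C> \<Longrightarrow> dependent_edges E \<phi> X"
    using assms(1) by (auto simp: contractible_dependent_partition_def)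
  \<comment> \<open>By dependence, the coordinate at any representative edge serves as the
    coefficient of the whole class.\<close>
  have "l $ e = l $ (SOME e. e \<in> X)" if "X \<in> \<C>" "e \<in> X" for X e
  proof -
    have "(SOME e. e \<in> X) \<in> X"
      using that(2) by (rule someI)
    then show ?thesis
      using dep[OF that(1)] that(2) assms(2) unfolding dependent_edges_def by blast
  qed
  moreover have "0 \<le> l $ e" "e \<notin> nondeg_edges E \<phi> \<Longrightarrow> l $ e = 0" for e
    using assms(2) by (auto simp: deformation_cone_iff deforms_with_def)
  ultimately show ?thesis
    using that[of "\<lambda>X. l $ (SOME e. e \<in> X)"] by blast
qed

lemma deformation_cone_eq_hull:
  assumes "contractible_dependent_partition E \<phi> \<C>"
  shows "deformation_cone E \<phi> = convex_cone hull (char_vec ` \<C>)"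
proof
  have part: "partition_on (nondeg_edges E \<phi>) \<C>"
    using assms by (simp add: contractible_dependent_partition_def)
  show "convex_cone hull (char_vec ` \<C>) \<subseteq> deformation_cone E \<phi>"
    using assms
    by (intro hull_minimal convex_cone_deformation_cone)
      (auto simp: contractible_dependent_partition_def contractible_edges_char_vec)
  show "deformation_cone E \<phi> \<subseteq> convex_cone hull (char_vec ` \<C>)"
  proof
    fix l assume "l \<in> deformation_cone E \<phi>"
    with assms obtain c where c: "\<And>X. X \<in> \<C> \<Longrightarrow> 0 \<le> c X"
      "\<And>X e. X \<in> \<C> \<Longrightarrow> e \<in> X \<Longrightarrow> l $ e = c X"
      "\<And>e. e \<notin> nondeg_edges E \<phi> \<Longrightarrow> l $ e = 0"
      by (rule deformation_cone_coefficients) blast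
    \<comment> \<open>On a class both sides equal its coefficient; off the support of \<phi> both
      vanish.\<close>
    have "l $ e = (\<Sum>X\<in>\<C>. c X *\<^sub>R char_vec X) $ e" for e
    proof (cases "e \<in> nondeg_edges E \<phi>")
      case True
      then obtain X where "X \<in> \<C>" "e \<in> X"
        using part by (auto simp: partition_on_def)
      then show ?thesis
        using c(2) sum_char_vec_partition[OF part, of X e c] by simp
    next
      case False
      then have "\<forall>X\<in>\<C>. e \<notin> X"
        using part by (auto simp: partition_on_def)
      then show ?thesis
        using c(3)[OF False] by (auto simp: char_vec_def)
    qed
    then have "l = (\<Sum>X\<in>\<C>. c X *\<^sub>R char_vec X)"
      by (simp add: vec_eq_iff)
    then show "l \<in> convex_cone hull (char_vec ` \<C>)"
      using c(1)
      by (auto intro!: convex_cone_sum convex_cone_convex_cone_hull convex_cone_hull_mul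
          simp: hull_inc)
  qed
qed

section \<open>Decompositions into indecomposable summands\<close>

lemma framework_of_edges_iff: "framework_of_edges E \<phi> X \<psi> \<longleftrightarrow> deforms_with E \<phi> (char_vec X) \<psi>"
  by (simp add: framework_of_edges_def deforms_with_iff)

lemma nondeg_edges_framework_of_edges:
  assumes "framework_of_edges E \<phi> X \<psi>"
  shows "nondeg_edges E \<psi> = X"
  using nondeg_edges_deformation[of E \<phi> "char_vec X" \<psi>] assms
  by (auto simp: framework_of_edges_iff char_vec_def)

lemma decomposition_partition:
  fixes E :: "'v::finite set set" and \<phi> :: "'v \<Rightarrow> real ^ 'd"
  assumes "partition_on (nondeg_edges E \<phi>) \<C>" "\<And>X. X \<in> \<C> \<Longrightarrow> framework_of_edges E \<phi> X (F X)"
  shows "decomposition V E \<phi> \<C> F"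
proof -
  have "(\<Sum>X\<in>\<C>. F X v) - (\<Sum>X\<in>\<C>. F X u) = \<phi> v - \<phi> u" if uv: "{u, v} \<in> E" for u v
  proof -
    have "(\<Sum>X\<in>\<C>. F X v) - (\<Sum>X\<in>\<C>. F X u) = (\<Sum>X\<in>\<C>. char_vec X $ {u, v} *\<^sub>R (\<phi> v - \<phi> u))"
      using assms(2) uv
      by (auto simp: framework_of_edges_iff deforms_with_def sum_subtractf[symmetric] intro!: sum.cong)
    \<comment> \<open>The factor 1 is inserted to match \<open>sum_char_vec_partition\<close> with
      all coefficients equal to 1.\<close>
    also have "\<dots> = (\<Sum>X\<in>\<C>. 1 *\<^sub>R char_vec X) $ {u, v} *\<^sub>R (\<phi> v - \<phi> u)"
      by (simp add: scaleR_sum_left)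
    also have "\<dots> = \<phi> v - \<phi> u"
    proof (cases "\<phi> u = \<phi> v")
      case False
      then have "{u, v} \<in> nondeg_edges E \<phi>"
        using uv by (simp add: nondeg_edges_iff)
      then obtain X where "X \<in> \<C>" "{u, v} \<in> X"
        using partition_onD1[OF assms(1)] by blast
      then show ?thesis
        using sum_char_vec_partition[OF assms(1), of X "{u, v}" "\<lambda>_. 1"] by simp
    qed simp
    finally show ?thesis .
  qed
  then show ?thesis
    using assms(2)
    by (auto simp: decomposition_def framework_of_edges_def intro: translation_equivI)
qed

text \<open>A deformation of \<psi> is also one of \<phi>, so dependence gives it a single factor on
  \<open>X\<close>; off \<open>X\<close> the edges of \<psi> are collapsed and stay so.
  Connectedness leaves only one translation.\<close>

lemma indecomposable_framework_of_edges:
  fixes E :: "'v::finite set set" and \<phi> :: "'v \<Rightarrow> real ^ 'd"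
  assumes "contractible_dependent_partition E \<phi> \<C>" "X \<in> \<C>" "framework_of_edges E \<phi> X \<psi>"
    and "connected_graph V E"
  shows "indecomposable V E \<psi>"
  unfolding indecomposable_def
proof (intro conjI allI impI)
  fix \<eta> assume \<eta>: "deformation E \<psi> \<eta>"
  have \<psi>: "\<psi> v - \<psi> u = char_vec X $ {u, v} *\<^sub>R (\<phi> v - \<phi> u)" if "{u, v} \<in> E" for u v
    using assms(3) that by (simp add: framework_of_edges_iff deforms_with_def)
  have def: "deformation E \<phi> \<eta>"
    unfolding deformation_def
  proof (intro allI impI)
    fix u v assume uv: "{u, v} \<in> E"
    obtain r where "0 \<le> r" "\<eta> v - \<eta> u = r *\<^sub>R (\<psi> v - \<psi> u)"
      using \<eta> uv by (auto simp: deformation_def)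
    then show "\<exists>l\<ge>0. \<eta> v - \<eta> u = l *\<^sub>R (\<phi> v - \<phi> u)"
      \<comment> \<open>The factors of successive deformations multiply.\<close>
      using \<psi>[OF uv] by (intro exI[of _ "r * char_vec X $ {u, v}"]) (simp add: char_vec_def)
  qed
  then obtain l where l: "deforms_with E \<phi> l \<eta>"
    by (simp add: deforms_with_iff)
  then have "l \<in> deformation_cone E \<phi>"
    by (auto simp: deformation_cone_iff)
  with assms(1) obtain c where c: "\<And>X. X \<in> \<C> \<Longrightarrow> 0 \<le> c X"
    "\<And>X e. X \<in> \<C> \<Longrightarrow> e \<in> X \<Longrightarrow> l $ e = c X"
    by (rule deformation_cone_coefficients) blast
  have "c X *\<^sub>R \<psi> v - c X *\<^sub>R \<psi> u = \<eta> v - \<eta> u" if uv: "{u, v} \<in> E" for u v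
  proof (cases "{u, v} \<in> X")
    case True
    then show ?thesis
      using \<psi>[OF uv] l uv c(2)[OF assms(2)]
      by (simp add: deforms_with_def char_vec_def scaleR_diff_right[symmetric])
  next
    case False
    then have "\<psi> v - \<psi> u = 0"
      using \<psi>[OF uv] by (simp add: char_vec_def)
    moreover obtain r where "\<eta> v - \<eta> u = r *\<^sub>R (\<psi> v - \<psi> u)"
      using \<eta> uv by (auto simp: deformation_def)
    ultimately show ?thesis
      by simp
  qed
  then obtain t where "\<And>v. v \<in> V \<Longrightarrow> \<eta> v = c X *\<^sub>R \<psi> v + t"
    using connected_graph_translationE[OF assms(4), of "\<lambda>v. c X *\<^sub>R \<psi> v" \<eta>] by blast
  then show "\<exists>\<alpha>\<ge>0. \<exists>t. \<forall>v\<in>V. \<eta> v = \<alpha> *\<^sub>R \<psi> v + t"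
    using c(1)[OF assms(2)] by blast
qed (rule assms(4))

text \<open>Once \<open>l\<close> is non-zero on a class \<open>X\<close>, the framework
  \<open>F\<close> of \<open>X\<close> is a deformation of \<psi>, hence a multiple of it up to
  translation. Comparing vectors then makes \<open>l\<close> vanish off \<open>X\<close>.\<close>

lemma indecomposable_deformation_scaled:
  fixes E :: "'v::finite set set" and \<phi> :: "'v \<Rightarrow> real ^ 'd"
  assumes fw: "framework V E \<phi>" and part: "contractible_dependent_partition E \<phi> \<C>"
    and l: "deforms_with E \<phi> l \<psi>" and indec: "indecomposable V E \<psi>"
    and ne: "nondeg_edges E \<psi> \<noteq> {}"
  obtains X a where "X \<in> \<C>" "0 < a" "l = a *\<^sub>R char_vec X"
proof -
  have "l \<in> deformation_cone E \<phi>"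
    using l by (auto simp: deformation_cone_iff)
  with part obtain c where c: "\<And>X. X \<in> \<C> \<Longrightarrow> 0 \<le> c X"
    "\<And>X e. X \<in> \<C> \<Longrightarrow> e \<in> X \<Longrightarrow> l $ e = c X"
    by (rule deformation_cone_coefficients) blast
  obtain e where e: "l $ e \<noteq> 0"
    using ne nondeg_edges_deformation[OF l] by blast
  then have eN: "e \<in> nondeg_edges E \<phi>"
    using l by (auto simp: deforms_with_def)
  then obtain X where X: "X \<in> \<C>" "e \<in> X"
    using part by (auto simp: contractible_dependent_partition_def partition_on_def)
  have XN: "X \<subseteq> nondeg_edges E \<phi>"
    using part X(1) by (auto simp: contractible_dependent_partition_def contractible_edges_def)
  have cX: "0 < c X"
    using c X e by (metis order_le_less)
  have "char_vec X \<in> deformation_cone E \<phi>"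
    using part X(1) by (simp add: contractible_dependent_partition_def contractible_edges_char_vec)
  then obtain F where F: "deforms_with E \<phi> (char_vec X) F"
    by (auto simp: deformation_cone_iff)
  have "deformation E \<psi> F"
    unfolding deformation_def
  proof (intro allI impI)
    fix u v assume uv: "{u, v} \<in> E"
    \<comment> \<open>On \<open>X\<close> the map \<psi> has factor \<open>c X\<close> and
      \<open>F\<close> has factor 1; off \<open>X\<close> the edges of \<open>F\<close> are
      collapsed.\<close>
    have "F v - F u = (char_vec X $ {u, v} / c X) *\<^sub>R (\<psi> v - \<psi> u)"
      using F l uv c(2)[OF X(1)] cX by (simp add: deforms_with_def char_vec_def)
    moreover have "0 \<le> char_vec X $ {u, v} / c X"
      using cX by (simp add: char_vec_def)
    ultimately show "\<exists>l\<ge>0. F v - F u = l *\<^sub>R (\<psi> v - \<psi> u)"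
      by blast
  qed
  then obtain \<alpha> t where \<alpha>: "0 \<le> \<alpha>" "\<And>v. v \<in> V \<Longrightarrow> F v = \<alpha> *\<^sub>R \<psi> v + t"
    using indec by (auto simp: indecomposable_def)
  have eq: "char_vec X $ f = \<alpha> * l $ f" for f
  proof (cases "f \<in> nondeg_edges E \<phi>")
    case True
    then obtain u v where uv: "f = {u, v}" "{u, v} \<in> E" "\<phi> u \<noteq> \<phi> v"
      by (rule nondeg_edges_cases)
    \<comment> \<open>The relation between \<open>F\<close> and \<psi> is known on \<open>V\<close>
      only, so the endpoints of the edge must be vertices of the framework.\<close>
    have "F v - F u = \<alpha> *\<^sub>R (\<psi> v - \<psi> u)"
      using \<alpha>(2) framework_edge_in[OF fw uv(2)] by (simp add: scaleR_diff_right)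
    then have "char_vec X $ f *\<^sub>R (\<phi> v - \<phi> u) = (\<alpha> * l $ f) *\<^sub>R (\<phi> v - \<phi> u)"
      using F l uv by (simp add: deforms_with_def)
    then show ?thesis
      using uv(3) by simp
  next
    case False
    then show ?thesis
      using XN l by (auto simp: deforms_with_def char_vec_def)
  qed
  \<comment> \<open>At the edge \<open>e\<close> of \<open>X\<close> the left side of
    \<open>eq\<close> is 1.\<close>
  have "\<alpha> \<noteq> 0"
    using eq[of e] X(2) by (auto simp: char_vec_def)
  then have "l = inverse \<alpha> *\<^sub>R char_vec X"
    using eq by (simp add: vec_eq_iff)
  then show ?thesis
    using that[OF X(1), of "inverse \<alpha>"] \<alpha>(1) \<open>\<alpha> \<noteq> 0\<close> by simp
qed

text \<open>Translations of components do not affect edge differences, so the factors of the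
  summands add up to the factor of \<phi> itself.\<close>

lemma decomposition_sum_edge_vectors:
  fixes E :: "'v::finite set set" and \<phi> :: "'v \<Rightarrow> real ^ 'd"
  assumes fw: "framework V E \<phi>" and dec: "decomposition V E \<phi> J \<psi>"
    and l: "\<And>j. j \<in> J \<Longrightarrow> deforms_with E \<phi> (l j) (\<psi> j)" and e: "e \<in> nondeg_edges E \<phi>"
  shows "(\<Sum>j\<in>J. l j $ e) = 1"
proof -
  obtain u v where uv: "e = {u, v}" "{u, v} \<in> E" "\<phi> u \<noteq> \<phi> v"
    using e by (rule nondeg_edges_cases)
  have "\<phi> v - \<phi> u = (\<Sum>j\<in>J. \<psi> j v) - (\<Sum>j\<in>J. \<psi> j u)"
    using translation_equivD[of V E "\<lambda>v. \<Sum>j\<in>J. \<psi> j v" \<phi> u v] dec uv(2)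
      framework_edge_in[OF fw uv(2)]
    by (simp add: decomposition_def)
  also have "\<dots> = (\<Sum>j\<in>J. l j $ e *\<^sub>R (\<phi> v - \<phi> u))"
    using l uv by (auto simp: deforms_with_def sum_subtractf[symmetric] intro!: sum.cong)
  finally have "(\<Sum>j\<in>J. l j $ e) *\<^sub>R (\<phi> v - \<phi> u) = 1 *\<^sub>R (\<phi> v - \<phi> u)"
    by (simp add: scaleR_sum_left)
  then show ?thesis
    using uv(3) by (metis scaleR_cancel_right right_minus_eq)
qed

text \<open>The matching sends a summand to its support, which is a class. Distinct supports make it
  injective, and the coordinate sums being 1 make it surjective and fix the scale of every
  summand.\<close>

lemma decomposition_unique:
  fixes E :: "'v::finite set set" and \<phi> :: "'v \<Rightarrow> real ^ 'd"
  assumes fw: "framework V E \<phi>" and part: "contractible_dependent_partition E \<phi> \<C>"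
    and F: "\<And>X. X \<in> \<C> \<Longrightarrow> framework_of_edges E \<phi> X (F X)"
    and dec: "decomposition V E \<phi> J \<psi>" and dist: "distinct_supports E J \<psi>"
    and indec: "\<And>j. j \<in> J \<Longrightarrow> indecomposable V E (\<psi> j)"
  shows "same_decomposition V E J \<psi> \<C> F"
proof -
  let ?N = "nondeg_edges E" and ?\<sigma> = "\<lambda>j. nondeg_edges E (\<psi> j)"
  have fin: "finite J"
    using dec by (simp add: decomposition_def)
  have pon: "partition_on (?N \<phi>) \<C>"
    using part by (simp add: contractible_dependent_partition_def)
  have disj: "X = Y" if "X \<in> \<C>" "Y \<in> \<C>" "e \<in> X" "e \<in> Y" for X Y e
    using pon that by (auto simp: partition_on_def disjoint_def)
  define l where "l j = edge_deformation_vector E \<phi> (\<psi> j)" for j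
  have l: "deforms_with E \<phi> (l j) (\<psi> j)" if "j \<in> J" for j
    using dec that by (simp add: decomposition_def deforms_with_iff l_def)
  have supp: "?\<sigma> j = {e. l j $ e \<noteq> 0}" if "j \<in> J" for j
    using nondeg_edges_deformation[OF l[OF that]] .
  have scaled: "?\<sigma> j \<in> \<C> \<and> (\<exists>a. l j = a *\<^sub>R char_vec (?\<sigma> j))" if j: "j \<in> J" "?\<sigma> j \<noteq> {}" for j
  proof -
    obtain X a where X: "X \<in> \<C>" "0 < a" "l j = a *\<^sub>R char_vec X"
      using indecomposable_deformation_scaled[OF fw part l[OF j(1)] indec[OF j(1)] j(2)] by blast
    then have "?\<sigma> j = X"
      using supp[OF j(1)] by (auto simp: char_vec_def)
    then show ?thesis
      using X by blast
  qed
  have sum1: "(\<Sum>j\<in>J. l j $ e) = 1" if "e \<in> ?N \<phi>" for e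
    by (rule decomposition_sum_edge_vectors[OF fw dec l that])
  have inj: "inj_on ?\<sigma> J"
    using dist by (simp add: distinct_supports_def)
  have one: "l j = char_vec (?\<sigma> j)" if j: "j \<in> J" "?\<sigma> j \<noteq> {}" for j
  proof -
    obtain a where a: "l j = a *\<^sub>R char_vec (?\<sigma> j)" and \<sigma>j: "?\<sigma> j \<in> \<C>"
      using scaled[OF j] by blast
    obtain e where e: "e \<in> ?\<sigma> j"
      using j(2) by blast
    \<comment> \<open>Another summand that is non-zero at \<open>e\<close> would be supported on the
      class containing \<open>e\<close>, thus have the same support as summand
      \<open>j\<close>.\<close>
    have "l i $ e = 0" if i: "i \<in> J - {j}" for i
    proof (rule ccontr)
      assume "l i $ e \<noteq> 0"
      then have "e \<in> ?\<sigma> i"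
        using supp i by blast
      then have "?\<sigma> i = ?\<sigma> j"
        using disj[of "?\<sigma> i" "?\<sigma> j" e] scaled[of i] \<sigma>j e i by blast
      then show False
        using inj_onD[OF inj, of i j] i j(1) by blast
    qed
    moreover have "e \<in> ?N \<phi>"
      using e \<sigma>j pon by (auto simp: partition_on_def)
    ultimately have "l j $ e = 1"
      using sum1[of e] fin j(1) by (simp add: sum.remove)
    then have "a = 1"
      using a e by (simp add: char_vec_def)
    then show ?thesis
      using a by simp
  qed
  have supp_F: "?N (F X) = X" if "X \<in> \<C>" for X
    using nondeg_edges_framework_of_edges[OF F[OF that]] .
  have "?\<sigma> ` {j \<in> J. ?\<sigma> j \<noteq> {}} = {X \<in> \<C>. ?N (F X) \<noteq> {}}"
  proof (intro equalityI subsetI)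
    fix X assume "X \<in> ?\<sigma> ` {j \<in> J. ?\<sigma> j \<noteq> {}}"
    then show "X \<in> {X \<in> \<C>. ?N (F X) \<noteq> {}}"
      using scaled supp_F by auto
  next
    fix X assume "X \<in> {X \<in> \<C>. ?N (F X) \<noteq> {}}"
    then obtain e where X: "X \<in> \<C>" and e: "e \<in> X"
      using supp_F by auto
    have "e \<in> ?N \<phi>"
      using e X partition_onD1[OF pon] by blast
    \<comment> \<open>Some summand must be non-zero at \<open>e\<close>, and its support is then the
      class \<open>X\<close>, so every class is attained.\<close>
    then have "(\<Sum>j\<in>J. l j $ e) \<noteq> 0"
      using sum1[of e] by simp
    then obtain j where j: "j \<in> J" "l j $ e \<noteq> 0"
      by (meson sum.neutral)
    then have "e \<in> ?\<sigma> j"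
      using supp by blast
    then have "?\<sigma> j = X"
      using disj[of "?\<sigma> j" X e] scaled[OF j(1)] X e by blast
    then show "X \<in> ?\<sigma> ` {j \<in> J. ?\<sigma> j \<noteq> {}}"
      using j(1) e by blast
  qed
  then have "bij_betw ?\<sigma> {j \<in> J. ?\<sigma> j \<noteq> {}} {X \<in> \<C>. ?N (F X) \<noteq> {}}"
    using inj by (auto simp: bij_betw_def intro: inj_on_subset)
  moreover have "translation_equiv V E (\<psi> j) (F (?\<sigma> j))" if j: "j \<in> J" "?\<sigma> j \<noteq> {}" for j
    using l[OF j(1)] F[of "?\<sigma> j"] scaled[OF j] one[OF j]
    by (intro translation_equivI) (simp add: framework_of_edges_iff deforms_with_def)
  ultimately show ?thesis
    unfolding same_decomposition_def by blast
qed

theorem theorem4p2p2: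
  fixes V :: "'v::finite set" and E :: "'v set set" and \<phi> :: "'v \<Rightarrow> real ^ 'd"
  assumes "framework V E \<phi>"
  shows "(edge_decomposable E \<phi> \<longrightarrow> uniquely_decomposable E \<phi>) \<and>
    (\<forall>\<C>. contractible_dependent_partition E \<phi> \<C> \<longrightarrow>
       simplicial_cone (deformation_cone E \<phi>) \<and>
       dim (deformation_cone E \<phi>) = card \<C> \<and>
       bij_betw (\<lambda>X. conic hull {char_vec X}) \<C> (rays (deformation_cone E \<phi>)) \<and>
       (\<forall>X\<in>\<C>. \<exists>\<psi>. framework_of_edges E \<phi> X \<psi>) \<and>
       (\<forall>F. (\<forall>X\<in>\<C>. framework_of_edges E \<phi> X (F X)) \<longrightarrow>
          decomposition V E \<phi> \<C> F \<and>
          distinct_supports E \<C> F \<and>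
          (connected_graph V E \<longrightarrow> (\<forall>X\<in>\<C>. indecomposable V E (F X))) \<and>
          (\<forall>(J :: 'i set) \<psi>.
             decomposition V E \<phi> J \<psi> \<and> distinct_supports E J \<psi> \<and>
             (\<forall>j\<in>J. indecomposable V E (\<psi> j)) \<longrightarrow>
             same_decomposition V E J \<psi> \<C> F)))"
proof -
  have simplicial: "simplicial_cone (deformation_cone E \<phi>)"
    if "contractible_dependent_partition E \<phi> \<C>" for \<C>
    using that deformation_cone_eq_hull simplicial_cone_convex_cone_hull
      independent_char_vec_partition
    by (metis contractible_dependent_partition_def)
  show ?thesis
  proof (intro conjI allI impI ballI)
    assume "edge_decomposable E \<phi>"
    then show "uniquely_decomposable E \<phi>"
      using simplicial by (auto simp: edge_decomposable_def uniquely_decomposable_def)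
  next
    fix \<C> assume part: "contractible_dependent_partition E \<phi> \<C>"
    then have pon: "partition_on (nondeg_edges E \<phi>) \<C>"
      by (simp add: contractible_dependent_partition_def)
    have ind: "independent (char_vec ` \<C>)"
      using independent_char_vec_partition[OF pon] .
    have inj: "inj_on char_vec \<C>"
      using inj_on_subset[OF inj_char_vec] by blast
    show "simplicial_cone (deformation_cone E \<phi>)"
      using simplicial part .
    show "dim (deformation_cone E \<phi>) = card \<C>"
      using dim_convex_cone_hull[OF ind] deformation_cone_eq_hull[OF part] card_image[OF inj]
      by simp
    \<comment> \<open>Injectivity is composed from two stages: distinct classes have distinct
      characteristic vectors, and these span distinct rays.\<close>
    show "bij_betw (\<lambda>X. conic hull {char_vec X}) \<C> (rays (deformation_cone E \<phi>))"
      using comp_inj_on[OF inj inj_on_conic_hull[OF ind]]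
      by (simp add: bij_betw_def deformation_cone_eq_hull[OF part] rays_convex_cone_hull[OF ind]
          image_image comp_def)
    show "\<exists>\<psi>. framework_of_edges E \<phi> X \<psi>" if "X \<in> \<C>" for X
      using part that contractible_edges_char_vec
      by (auto simp: contractible_dependent_partition_def framework_of_edges_iff
          deformation_cone_iff[symmetric])
    fix F assume "\<forall>X\<in>\<C>. framework_of_edges E \<phi> X (F X)"
    then have F: "\<And>X. X \<in> \<C> \<Longrightarrow> framework_of_edges E \<phi> X (F X)"
      by blast
    show "decomposition V E \<phi> \<C> F"
      using decomposition_partition[OF pon F] .
    show "distinct_supports E \<C> F"
      using nondeg_edges_framework_of_edges[OF F] by (simp add: distinct_supports_def inj_on_def)
    show "indecomposable V E (F X)" if "connected_graph V E" "X \<in> \<C>" for X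
      using indecomposable_framework_of_edges[OF part that(2) F[OF that(2)] that(1)] .
    show "same_decomposition V E J \<psi> \<C> F"
      if "decomposition V E \<phi> J \<psi> \<and> distinct_supports E J \<psi> \<and> (\<forall>j\<in>J. indecomposable V E (\<psi> j))"
      for J :: "'i set" and \<psi>
      using decomposition_unique[OF assms part F, of J \<psi>] that by blast
  qed
qed

end
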